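(* Let $d\ge 2$ and $k\ge 4$ be integers and let $G$ be a $K_{1,d}$-free graph with a strong bramble $\mathcal{B}$ of $\alpha$-order at least $dk$. Then there exists an induced cycle $C$ of length at least $k$ in $G$.
   Context: All graphs are finite, simple, and undirected. $K_{1,d}$ is the star with $d$ leaves; $G$ is $K_{1,d}$-free if it does not contain $K_{1,d}$ as an induced subgraph. For $X\subseteq V(G)$, $\alpha(X)$ denotes the maximum size of an independent set in $G[X]$; $X$ is connected if $G[X]$ is connected. A strong bramble in $G$ is a collection $\mathcal{B}=\{B_1,\dots,B_n\}$ of connected sets $B_i\subseteq V(G)$ such that $B_i\cap B_j\ne\emptyset$ for all $i,j\in\{1,\dots,n\}$. A cover for $\mathcal{B}$ is a set $X\subseteq V(G)$ with $B_i\cap X\ne\emptyset$ for all $i$. The $\alpha$-order of $\mathcal{B}$ is $\min\{\alpha(X): X\subseteq V(G)\text{ is a cover for }\mathcal{B}\}$. *)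

theory Defs
  imports "Graph_Theory.Graph_Theory"
begin

text \<open>
  Following the Graph\_Theory entry, a finite simple undirected graph is a symmetric digraph
  without loops and parallel arcs (locale \<^locale>\<open>graph\<close>): the edge \<open>uv\<close> is the pair of
  arcs from \<open>u\<close> to \<open>v\<close> and back. Induced subgraphs, connectedness and the
  complete bipartite graphs \<open>K\<^bsub>m,n\<^esub>\<close> are those of that entry.
\<close>

definition K1_free :: "nat \<Rightarrow> ('a, 'b) pre_digraph \<Rightarrow> bool" where
  "K1_free d G \<longleftrightarrow> \<not> (\<exists>H. induced_subgraph H G \<and> K\<^bsub>1,d\<^esub> H)"

definition independent_set :: "('a, 'b) pre_digraph \<Rightarrow> 'a set \<Rightarrow> bool" where
  "independent_set G S \<longleftrightarrow> S \<subseteq> verts G \<and> (\<forall>u\<in>S. \<forall>v\<in>S. \<not> u \<rightarrow>\<^bsub>G\<^esub> v)"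

definition alpha :: "('a, 'b) pre_digraph \<Rightarrow> 'a set \<Rightarrow> nat" where
  "alpha G X = Max {card S | S. independent_set (G \<restriction> X) S}"

definition strong_bramble :: "('a, 'b) pre_digraph \<Rightarrow> 'a set set \<Rightarrow> bool" where
  "strong_bramble G \<B> \<longleftrightarrow>
     (\<forall>B\<in>\<B>. B \<subseteq> verts G \<and> connected (G \<restriction> B)) \<and> (\<forall>B\<in>\<B>. \<forall>B'\<in>\<B>. B \<inter> B' \<noteq> {})"

definition bramble_cover :: "('a, 'b) pre_digraph \<Rightarrow> 'a set set \<Rightarrow> 'a set \<Rightarrow> bool" where
  "bramble_cover G \<B> X \<longleftrightarrow> X \<subseteq> verts G \<and> (\<forall>B\<in>\<B>. B \<inter> X \<noteq> {})"

text \<open>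
  The members of a strong bramble are nonempty, so \<open>verts G\<close> is always a cover and the
  minimum is over a nonempty finite set.
\<close>

definition alpha_order :: "('a, 'b) pre_digraph \<Rightarrow> 'a set set \<Rightarrow> nat" where
  "alpha_order G \<B> = Min {alpha G X | X. bramble_cover G \<B> X}"

text \<open>
  \<open>C\<close> is a cycle of length \<open>n\<close> as a graph: a closed walk \<open>p\<close> without repeated vertices passes
  through all vertices of \<open>C\<close>, and the edges of \<open>C\<close> are exactly those traversed by \<open>p\<close>. The
  bound \<open>3 \<le> n\<close> is needed because \<^const>\<open>pre_digraph.cycle\<close> admits going along an edge
  and back. For a symmetric digraph every edge also contributes the reversed arc.
\<close>

definition cycle_graph :: "nat \<Rightarrow> ('a, 'b) pre_digraph \<Rightarrow> bool" where
  "cycle_graph n C \<longleftrightarrow> graph C \<and> 3 \<le> n \<and>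
     (\<exists>p. pre_digraph.cycle C p \<and> length p = n \<and> verts C = tail C ` set p \<and>
          arcs_ends C = arc_to_ends C ` set p \<union> (arc_to_ends C ` set p)\<inverse>)"

end

theory Submission
  imports Defs
begin

text \<open>
  Write \<open>N[P]\<close> for the closed neighbourhood of the vertex set of an induced path \<open>P\<close>. In a
  \<open>K\<^bsub>1,d\<^esub>\<close>-free graph every closed neighbourhood of a vertex has independence number at most
  \<open>d - 1\<close>, so \<open>N[P]\<close> has independence number at most \<open>(d - 1) \<cdot> \<bar>P\<bar>\<close>
  (\<open>alpha_closed_nbhd\<close>). Hence, when the \<open>\<alpha>\<close>-order is at least \<open>dk\<close>, no
  \<open>N[P]\<close> with \<open>\<bar>P\<bar> \<le> k - 2\<close> is a cover. What remains is a statement about arbitrary graphs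
  (\<open>long_induced_cycle\<close>): if no induced path on at most \<open>m \<ge> 2\<close> vertices has a closed
  neighbourhood covering a strong bramble, then there is an induced cycle of length at least
  \<open>m + 2\<close>.

  For each such \<open>P\<close> some bramble member avoids \<open>N[P]\<close>, and since bramble members are connected and
  pairwise intersect, exactly one component \<open>D(P)\<close> of \<open>G - N[P]\<close> contains bramble members. Take
  \<open>P\<close> such that \<open>D = D(P)\<close> is as small as possible and, subject to that, \<open>P\<close> is as short as possible.
  All neighbours of \<open>D\<close> outside \<open>D\<close> lie in \<open>N[P]\<close>. If they all lay in the closed neighbourhood of
  \<open>P\<close> without one of its ends, deleting that end would give a shorter path with the same
  \<open>D\<close> (\<open>big_part_eqI\<close>). So each end of \<open>P\<close> is, on \<open>P\<close>, the only
  neighbour of some vertex in the boundary of \<open>D\<close>: call such a vertex \<open>a\<close> for the first end and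
  \<open>b\<close> for the last end. If \<open>\<bar>P\<bar> < m\<close>, appending \<open>b\<close> to \<open>P\<close> gives an induced path whose closed
  neighbourhood contains a vertex of \<open>D\<close>, contradicting the minimality of \<open>D\<close>. So
  \<open>\<bar>P\<bar> = m\<close>, and \<open>P\<close> followed by an induced path from \<open>b\<close> to \<open>a\<close> through \<open>D\<close> is an induced
  cycle, as no vertex of \<open>P\<close> has a neighbour in \<open>D\<close>.
\<close>

(* The arrow of function spaces would make every adjacency statement ambiguous. *)
unbundle no funcset_syntax

section \<open>Adjacency and connected vertex sets\<close>

context graph
begin

lemma adj_sym: "u \<rightarrow> v \<longleftrightarrow> v \<rightarrow> u"
  using arcs_ends_symmetric[OF sym_arcs] by blast

lemma adj_irrefl: "\<not> u \<rightarrow> u"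
  using adj_not_same by blast

lemma adj_induce: "u \<rightarrow>\<^bsub>G \<restriction> S\<^esub> v \<longleftrightarrow> u \<rightarrow> v \<and> u \<in> S \<and> v \<in> S"
  by (force simp: arcs_ends_def arc_to_ends_def)

lemma graph_induce:
  assumes "S \<subseteq> verts G"
  shows "graph (G \<restriction> S)"
proof -
  have "induced_subgraph (G \<restriction> S) G" using assms by (rule induced_induce)
  then show ?thesis
    using digraphI_induced induced_graph_imp_symmetric[OF sym_arcs] digraph.graphI by blast
qed

lemma connected_induce_iff:
  assumes "S \<subseteq> verts G"
  shows "connected (G \<restriction> S) \<longleftrightarrow> S \<noteq> {} \<and> (\<forall>u\<in>S. \<forall>v\<in>S. u \<rightarrow>\<^sup>*\<^bsub>G \<restriction> S\<^esub> v)"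
proof -
  interpret S: graph "G \<restriction> S" using assms by (rule graph_induce)
  show ?thesis
    unfolding connected_def strongly_connected_def
    using S.reachable_mk_symmetric_eq by (simp add: S.sym_arcs)
qed

lemma connected_induce_Union:
  assumes "\<A> \<noteq> {}" and sub: "\<And>A. A \<in> \<A> \<Longrightarrow> A \<subseteq> verts G"
    and con: "\<And>A. A \<in> \<A> \<Longrightarrow> connected (G \<restriction> A)"
    and meet: "\<And>A B. A \<in> \<A> \<Longrightarrow> B \<in> \<A> \<Longrightarrow> A \<inter> B \<noteq> {}"
  shows "connected (G \<restriction> \<Union>\<A>)"
proof -
  have subU: "\<Union>\<A> \<subseteq> verts G" using sub by blast
  interpret U: graph "G \<restriction> \<Union>\<A>" using subU by (rule graph_induce)
  have within: "u \<rightarrow>\<^sup>*\<^bsub>G \<restriction> \<Union>\<A>\<^esub> v" if "A \<in> \<A>" "u \<in> A" "v \<in> A" for A u v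
    using con[OF that(1)] that connected_induce_iff[OF sub]
    by (meson Union_upper reachable_induce_ss)
  have "u \<rightarrow>\<^sup>*\<^bsub>G \<restriction> \<Union>\<A>\<^esub> v" if "A \<in> \<A>" "u \<in> A" "B \<in> \<A>" "v \<in> B" for A B u v
  proof -
    have "A \<inter> B \<noteq> {}" using meet that by blast
    then obtain w where "w \<in> A" "w \<in> B" by blast
    then show ?thesis using within that U.reachable_trans by blast
  qed
  moreover have "\<Union>\<A> \<noteq> {}" using assms(1) con connected_induce_iff[OF sub] by blast
  ultimately show ?thesis using connected_induce_iff[OF subU] by blast
qed

lemma connected_induce_insert:
  assumes "S \<subseteq> verts G" "connected (G \<restriction> S)" "u \<in> S" "u \<rightarrow> v"
  shows "connected (G \<restriction> insert v S)"
proof -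
  have v: "v \<in> verts G" using assms(4) by (rule adj_in_verts)
  then have sub: "insert v S \<subseteq> verts G" using assms(1) by simp
  interpret I: graph "G \<restriction> insert v S" using sub by (rule graph_induce)
  have edge: "u \<rightarrow>\<^bsub>G \<restriction> insert v S\<^esub> v" "v \<rightarrow>\<^bsub>G \<restriction> insert v S\<^esub> u"
    unfolding adj_induce using assms(3,4) adj_sym by auto
  have old: "x \<rightarrow>\<^sup>*\<^bsub>G \<restriction> insert v S\<^esub> y" if "x \<in> S" "y \<in> S" for x y
    using assms(2) that reachable_induce_ss[OF _ subset_insertI]
    unfolding connected_induce_iff[OF assms(1)] by blast
  have "x \<rightarrow>\<^sup>*\<^bsub>G \<restriction> insert v S\<^esub> v" "v \<rightarrow>\<^sup>*\<^bsub>G \<restriction> insert v S\<^esub> x" if "x \<in> S" for x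
    using I.reachable_adj_trans[OF old[OF that assms(3)] edge(1)]
      I.adj_reachable_trans[OF edge(2) old[OF assms(3) that]] .
  then show ?thesis
    unfolding connected_induce_iff[OF sub] using old I.reachable_refl[of v] by simp
qed

lemma connected_induce_boundary:
  assumes "S \<subseteq> verts G" "connected (G \<restriction> S)" "T \<subset> S" "T \<noteq> {}"
  obtains u v where "u \<in> T" "v \<in> S - T" "u \<rightarrow> v"
proof -
  obtain x y where xy: "x \<in> T" "y \<in> S - T" using assms by blast
  have "x \<rightarrow>\<^sup>*\<^bsub>G \<restriction> S\<^esub> y" using assms xy connected_induce_iff by blast
  then have "\<exists>u\<in>T. \<exists>v\<in>S - T. u \<rightarrow> v" using xy
  proof (induction rule: wf_digraph.converse_reachable_induct[OF wellformed_induce_subgraph, consumes 1])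
    case 1 then show ?case by blast
  next
    case (2 x z) then show ?case using adj_induce by blast
  qed
  then show thesis using that by blast
qed

section \<open>Closed neighbourhoods and induced paths\<close>

definition closed_nbhd :: "'a set \<Rightarrow> 'a set" where
  "closed_nbhd X = X \<union> {v. \<exists>u\<in>X. u \<rightarrow> v}"

lemma closed_nbhd_subset_verts: "X \<subseteq> verts G \<Longrightarrow> closed_nbhd X \<subseteq> verts G"
  using adj_in_verts by (auto simp: closed_nbhd_def)

lemma closed_nbhd_mono: "X \<subseteq> Y \<Longrightarrow> closed_nbhd X \<subseteq> closed_nbhd Y"
  by (auto simp: closed_nbhd_def)

text \<open>
  An induced path is represented by its list of vertices. Peeling off the first vertex, which may be
  adjacent to nothing but its successor, makes the induction and concatenation arguments
  below free of indices.
\<close>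

primrec induced_path :: "'a list \<Rightarrow> bool" where
  "induced_path [] \<longleftrightarrow> True"
| "induced_path (x # xs) \<longleftrightarrow> x \<in> verts G \<and> x \<notin> set xs \<and> induced_path xs \<and>
     (\<forall>y\<in>set xs. x \<rightarrow> y \<longleftrightarrow> y = hd xs)"

lemma induced_path_imp: "induced_path xs \<Longrightarrow> distinct xs \<and> set xs \<subseteq> verts G"
  by (induction xs) auto

lemma induced_path_append:
  "induced_path (xs @ ys) \<longleftrightarrow> induced_path xs \<and> induced_path ys \<and> set xs \<inter> set ys = {} \<and>
     (\<forall>x\<in>set xs. \<forall>y\<in>set ys. x \<rightarrow> y \<longleftrightarrow> x = last xs \<and> y = hd ys)"
proof (induction xs)
  case (Cons x xs)
  then show ?case
    by (cases "xs = []") (auto simp: hd_append dest: hd_in_set)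
qed simp

lemma induced_path_tl: "induced_path xs \<Longrightarrow> induced_path (tl xs)"
  by (cases xs) auto

lemma induced_path_butlast: "induced_path xs \<Longrightarrow> induced_path (butlast xs)"
  by (cases xs rule: rev_cases) (auto simp: induced_path_append)

text \<open>
  Walk along \<open>ys\<close> to the last vertex that equals \<open>x\<close> or is adjacent to it, and continue from there: the
  vertices after it are not adjacent to \<open>x\<close>, so prefixing \<open>x\<close> keeps the path induced. This replaces the usual
  appeal to shortest walks.
\<close>

lemma induced_path_shortcut:
  assumes "induced_path ys" "x \<in> verts G" "\<exists>y\<in>set ys. x = y \<or> x \<rightarrow> y"
  shows "\<exists>xs. induced_path xs \<and> xs \<noteq> [] \<and> hd xs = x \<and> last xs = last ys \<and> set xs \<subseteq> insert x (set ys)"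
  using assms
proof (induction ys)
  case (Cons y ys)
  show ?case
  proof (cases "\<exists>z\<in>set ys. x = z \<or> x \<rightarrow> z")
    case True
    then obtain xs where "induced_path xs \<and> xs \<noteq> [] \<and> hd xs = x \<and> last xs = last ys \<and> set xs \<subseteq> insert x (set ys)"
      using Cons by auto
    moreover have "ys \<noteq> []" using True by auto
    ultimately show ?thesis by (intro exI[of _ xs]) auto
  next
    case False
    then consider "x = y" | "x \<noteq> y" "x \<rightarrow> y" using Cons.prems by auto
    then show ?thesis
    proof cases
      case 1 then show ?thesis using Cons.prems by (intro exI[of _ "y # ys"]) auto
    next
      case 2 then show ?thesis using Cons.prems False by (intro exI[of _ "x # y # ys"]) auto
    qed
  qed
qed simp

lemma connected_induced_path:
  assumes "S \<subseteq> verts G" "connected (G \<restriction> S)" "a \<in> S" "b \<in> S"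
  obtains xs where "induced_path xs" "xs \<noteq> []" "hd xs = a" "last xs = b" "set xs \<subseteq> S"
proof -
  have "a \<rightarrow>\<^sup>*\<^bsub>G \<restriction> S\<^esub> b" using assms connected_induce_iff by blast
  then have "\<exists>xs. induced_path xs \<and> xs \<noteq> [] \<and> hd xs = a \<and> last xs = b \<and> set xs \<subseteq> S"
  proof (induction rule: wf_digraph.converse_reachable_induct[OF wellformed_induce_subgraph, consumes 1])
    case 1 then show ?case using assms by (intro exI[of _ "[b]"]) auto
  next
    case (2 x y)
    then obtain ys where ys: "induced_path ys" "ys \<noteq> []" "hd ys = y" "last ys = b" "set ys \<subseteq> S"
      by blast
    have x: "x \<in> S" "x \<rightarrow> y" using 2 adj_induce by blast+
    then show ?case
      using induced_path_shortcut[of ys x] ys assms(1) hd_in_set[of ys] by fastforce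
  qed
  then show thesis using that by blast
qed

text \<open>
  The list of vertices is turned into a walk in the sense of arcs. Since the path is induced,
  the arcs of this walk account, up to reversal, for all adjacencies among its vertices.
\<close>

lemma induced_path_awalk:
  assumes "induced_path xs" "xs \<noteq> []"
  shows "\<exists>es. set es \<subseteq> arcs G \<and> cas (hd xs) es (last xs) \<and> awalk_verts (hd xs) es = xs \<and>
    (\<forall>x\<in>set xs. \<forall>y\<in>set xs. x \<rightarrow> y \<longrightarrow>
      (x, y) \<in> arc_to_ends G ` set es \<union> (arc_to_ends G ` set es)\<inverse>)"
  using assms
proof (induction xs)
  case (Cons x xs)
  show ?case
  proof (cases "xs = []")
    case True
    then show ?thesis using adj_irrefl by (intro exI[of _ "[]"]) auto
  next
    case False
    obtain es where es: "set es \<subseteq> arcs G" "cas (hd xs) es (last xs)" "awalk_verts (hd xs) es = xs"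
      "\<forall>u\<in>set xs. \<forall>y\<in>set xs. u \<rightarrow> y \<longrightarrow>
        (u, y) \<in> arc_to_ends G ` set es \<union> (arc_to_ends G ` set es)\<inverse>"
      using Cons False by auto
    have xx: "\<forall>y\<in>set xs. x \<rightarrow> y \<longleftrightarrow> y = hd xs" using Cons.prems by simp
    then obtain e where e: "e \<in> arcs G" "tail G e = x" "head G e = hd xs"
      using False by (metis hd_in_set reachableE)
    have xx': "\<forall>y\<in>set xs. y \<rightarrow> x \<longleftrightarrow> y = hd xs" using xx adj_sym by blast
    have ends: "arc_to_ends G e = (x, hd xs)" using e by (simp add: arc_to_ends_def)
    show ?thesis
      using es e False xx xx' adj_irrefl[of x] ends by (intro exI[of _ "e # es"]) auto
  qed
qed simp

text \<open>
  An induced cycle is an induced path together with one more vertex that sees exactly the two ends of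
  the path. With only one vertex on the path the result would be an edge, hence the lower bound.
\<close>

lemma induced_cycle_graph:
  assumes xs: "induced_path xs" "2 \<le> length xs" and v: "v \<in> verts G" "v \<notin> set xs"
    and vx: "\<forall>y\<in>set xs. v \<rightarrow> y \<longleftrightarrow> y = hd xs \<or> y = last xs"
  shows "cycle_graph (Suc (length xs)) (G \<restriction> insert v (set xs))"
proof -
  let ?S = "insert v (set xs)"
  have ne: "xs \<noteq> []" using xs by auto
  have S: "?S \<subseteq> verts G" using xs v induced_path_imp by auto
  interpret C: graph "G \<restriction> ?S" using S by (rule graph_induce)
  obtain es where es: "set es \<subseteq> arcs G" "cas (hd xs) es (last xs)" "awalk_verts (hd xs) es = xs"
      "\<forall>x\<in>set xs. \<forall>y\<in>set xs. x \<rightarrow> y \<longrightarrow>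
        (x, y) \<in> arc_to_ends G ` set es \<union> (arc_to_ends G ` set es)\<inverse>"
    using induced_path_awalk[OF xs(1) ne] by blast
  have "v \<rightarrow> hd xs" "last xs \<rightarrow> v" using vx ne adj_sym by auto
  then obtain e f where e: "e \<in> arcs G" "tail G e = v" "head G e = hd xs"
    and f: "f \<in> arcs G" "tail G f = last xs" "head G f = v"
    by (meson reachableE)
  define p where "p = e # es @ [f]"
  have "es \<noteq> []"
  proof
    assume "es = []"
    then have "length xs = 1" using length_awalk_verts[of "hd xs" es] unfolding es(3) by simp
    then show False using xs(2) by simp
  qed
  then have xs_conv: "xs = map (tail G) es @ [head G (last es)]"
    using es(3) by (simp add: awalk_verts_conv)
  then have last: "last xs = head G (last es)" by simp
  have tails: "map (tail G) p = v # xs" using xs_conv last e f by (simp add: p_def)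
  have verts: "awalk_verts v p = v # xs @ [v]"
    using tails e f by (simp add: awalk_verts_conv p_def)
  have cas_app: "cas u (es @ [f]) v" if "cas u es (last xs)" for u
    using that f by (induction es arbitrary: u) auto
  have cas: "cas v p v" using cas_app[OF es(2)] e by (simp add: p_def)
  have arcs_p: "set p \<subseteq> arcs G" using es e f by (simp add: p_def)
  have "awalk v p v" using v cas arcs_p by (simp add: awalk_def)
  then have walk: "C.awalk v p v" using verts by (intro awalk_induce) auto
  have "C.cycle p"
    unfolding C.cycle_def using walk verts xs v induced_path_imp
    by (intro exI[of _ v]) (auto simp: awalk_verts_induce p_def)
  moreover have "length p = Suc (length xs)" using tails by (metis length_Cons length_map)
  moreover have "tail G ` set p = ?S" using tails by (metis list.set_map list.simps(15))
  moreover have "arcs_ends (G \<restriction> ?S) = arc_to_ends G ` set p \<union> (arc_to_ends G ` set p)\<inverse>" (is "?L = ?R")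
  proof
    have "set p \<subseteq> arcs (G \<restriction> ?S)" using walk unfolding C.awalk_def by blast
    then have "arc_to_ends G ` set p \<subseteq> ?L" unfolding arcs_ends_def induce_subgraph_ends by blast
    then show "?R \<subseteq> ?L" using C.adj_sym by auto
    have ends: "arc_to_ends G e = (v, hd xs)" "arc_to_ends G f = (last xs, v)"
      using e f by (simp_all add: arc_to_ends_def)
    have used: "(x, y) \<in> ?R" if "x \<rightarrow> y" "x \<in> ?S" "y \<in> ?S" for x y
    proof -
      have "x = v \<and> y \<in> set xs \<or> y = v \<and> x \<in> set xs \<or> x \<in> set xs \<and> y \<in> set xs"
        using that adj_irrefl[of v] by auto
      then consider "x = v" "y \<in> set xs" | "y = v" "x \<in> set xs" | "x \<in> set xs" "y \<in> set xs"
        by blast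
      then show ?thesis
      proof cases
        case 1 then show ?thesis using vx that ends by (auto simp: p_def)
      next
        case 2 then show ?thesis using vx that ends adj_sym by (auto simp: p_def)
      next
        case 3 then show ?thesis using es(4) that by (auto simp: p_def)
      qed
    qed
    show "?L \<subseteq> ?R"
    proof (rule subrelI)
      fix x y assume "x \<rightarrow>\<^bsub>G \<restriction> ?S\<^esub> y"
      then have "x \<rightarrow> y" "x \<in> ?S" "y \<in> ?S" unfolding adj_induce by blast+
      then show "(x, y) \<in> ?R" by (rule used)
    qed
  qed
  ultimately show ?thesis
    unfolding cycle_graph_def using C.graph_axioms xs(2) by auto
qed

section \<open>The component favoured by a strong bramble\<close>

text \<open>
  If \<open>Z\<close> does not cover the strong bramble \<open>\<B>\<close>, this is the component of \<open>G - Z\<close> that contains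
  members of \<open>\<B>\<close>. As a union of all connected sets that contain a member and avoid \<open>Z\<close>, it is visibly
  antitone in \<open>Z\<close> and contains every connected set that competes with it.
\<close>

definition big_part :: "'a set set \<Rightarrow> 'a set \<Rightarrow> 'a set" where
  "big_part \<B> Z = \<Union>{Y. Y \<subseteq> verts G - Z \<and> connected (G \<restriction> Y) \<and> (\<exists>B\<in>\<B>. B \<subseteq> Y)}"

lemma big_part_antimono: "Z \<subseteq> Z' \<Longrightarrow> big_part \<B> Z' \<subseteq> big_part \<B> Z"
  unfolding big_part_def by (rule Union_mono) blast

lemma big_part_subset: "big_part \<B> Z \<subseteq> verts G - Z"
  unfolding big_part_def by blast

lemma subset_big_part:
  "Y \<subseteq> verts G - Z \<Longrightarrow> connected (G \<restriction> Y) \<Longrightarrow> B \<in> \<B> \<Longrightarrow> B \<subseteq> Y \<Longrightarrow> Y \<subseteq> big_part \<B> Z"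
  unfolding big_part_def by blast

lemma bramble_member_in_big_part:
  assumes "strong_bramble G \<B>" "Z \<subseteq> verts G" "\<not> bramble_cover G \<B> Z"
  obtains B where "B \<in> \<B>" "B \<subseteq> big_part \<B> Z"
proof -
  obtain B where B: "B \<in> \<B>" "B \<inter> Z = {}" using assms by (auto simp: bramble_cover_def)
  then have "B \<subseteq> verts G - Z" "connected (G \<restriction> B)" using assms by (auto simp: strong_bramble_def)
  then show thesis using that B subset_big_part[of B Z B] by blast
qed

lemma connected_big_part:
  assumes "strong_bramble G \<B>" "Z \<subseteq> verts G" "\<not> bramble_cover G \<B> Z"
  shows "connected (G \<restriction> big_part \<B> Z)"
  unfolding big_part_def
proof (rule connected_induce_Union, goal_cases)
  case 1
  obtain B where "B \<in> \<B>" "B \<inter> Z = {}" using assms by (auto simp: bramble_cover_def)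
  then show ?case using assms(1) by (auto simp: strong_bramble_def)
next
  case (4 X Y)
  then obtain B B' where "B \<in> \<B>" "B \<subseteq> X" "B' \<in> \<B>" "B' \<subseteq> Y" by blast
  then show ?case using assms(1) unfolding strong_bramble_def by blast
qed blast+

text \<open>
  Otherwise \<open>v\<close> could be added to the big part, which already contains every connected set of its kind.
\<close>

lemma big_part_boundary:
  assumes "strong_bramble G \<B>" "Z \<subseteq> verts G" "\<not> bramble_cover G \<B> Z"
    and "u \<in> big_part \<B> Z" "u \<rightarrow> v" "v \<notin> big_part \<B> Z"
  shows "v \<in> Z"
proof (rule ccontr)
  assume "v \<notin> Z"
  obtain B where B: "B \<in> \<B>" "B \<subseteq> big_part \<B> Z"
    using bramble_member_in_big_part[OF assms(1-3)] .
  have sub: "big_part \<B> Z \<subseteq> verts G" using big_part_subset by blast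
  have "connected (G \<restriction> insert v (big_part \<B> Z))"
    using connected_induce_insert[OF sub connected_big_part[OF assms(1-3)] assms(4,5)] .
  moreover have "insert v (big_part \<B> Z) \<subseteq> verts G - Z"
    using big_part_subset[of \<B> Z] \<open>v \<notin> Z\<close> adj_in_verts[OF assms(5)] by simp
  ultimately have "insert v (big_part \<B> Z) \<subseteq> big_part \<B> Z"
    using B by (intro subset_big_part) auto
  then show False using assms(6) by blast
qed

text \<open>
  A smaller obstacle \<open>Z'\<close> that still contains the boundary of the big part cannot enlarge it: growing beyond
  it, inside a connected set that avoids \<open>Z'\<close>, would need an edge leaving it, and that edge ends
  in \<open>Z'\<close>.
\<close>

lemma big_part_eqI:
  assumes bramble: "strong_bramble G \<B>" and Z: "Z \<subseteq> verts G" "\<not> bramble_cover G \<B> Z" and "Z' \<subseteq> Z"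
    and boundary: "\<And>u v. u \<in> big_part \<B> Z \<Longrightarrow> u \<rightarrow> v \<Longrightarrow> v \<notin> big_part \<B> Z \<Longrightarrow> v \<in> Z'"
  shows "big_part \<B> Z' = big_part \<B> Z"
proof (rule ccontr)
  assume "big_part \<B> Z' \<noteq> big_part \<B> Z"
  then have psub: "big_part \<B> Z \<subset> big_part \<B> Z'"
    using big_part_antimono[OF \<open>Z' \<subseteq> Z\<close>, of \<B>] by auto
  have sub: "big_part \<B> W \<subseteq> verts G" for W using big_part_subset[of \<B> W] by blast
  have Z': "Z' \<subseteq> verts G" "\<not> bramble_cover G \<B> Z'"
    using Z \<open>Z' \<subseteq> Z\<close> unfolding bramble_cover_def by blast+
  have "connected (G \<restriction> big_part \<B> Z)" using bramble Z by (rule connected_big_part)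
  then have "big_part \<B> Z \<noteq> {}" using connected_induce_iff[OF sub] by blast
  then obtain u v where uv: "u \<in> big_part \<B> Z" "v \<in> big_part \<B> Z' - big_part \<B> Z" "u \<rightarrow> v"
    using connected_induce_boundary[OF sub connected_big_part[OF bramble Z'] psub] by blast
  then have "v \<in> Z'" using boundary by blast
  then show False using uv(2) big_part_subset[of \<B> Z'] by blast
qed

section \<open>Long induced cycles from brambles without dominated covers\<close>

text \<open>
  The minimal choice of \<open>P\<close> becomes an induction on the pair of the size of \<open>D P\<close> and the length of \<open>P\<close>:
  every induced path on at most \<open>m\<close> vertices either gives the cycle directly or leads
  to one with a lexicographically smaller pair.
  The empty path, with empty neighbourhood, starts the induction.
\<close>

lemma long_induced_cycle:
  assumes bramble: "strong_bramble G \<B>" and "2 \<le> m"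
    and no_cover: "\<And>P. induced_path P \<Longrightarrow> length P \<le> m \<Longrightarrow> \<not> bramble_cover G \<B> (closed_nbhd (set P))"
  shows "\<exists>C n. induced_subgraph C G \<and> cycle_graph n C \<and> m + 2 \<le> n"
proof -
  define D where "D P = big_part \<B> (closed_nbhd (set P))" for P
  have D_verts: "D P \<subseteq> verts G" for P
    unfolding D_def using big_part_subset[of \<B> "closed_nbhd (set P)"] by blast
  have finD: "finite (D P)" for P using D_verts finite_verts by (rule finite_subset)
  have nbhd_verts: "closed_nbhd (set P) \<subseteq> verts G" if "induced_path P" for P
    using that closed_nbhd_subset_verts induced_path_imp by blast
  have shrink: "card (D Q) < card (D P)" if "set P \<subseteq> set Q" "u \<in> D P" "u \<in> closed_nbhd (set Q)" for P Q u
  proof -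
    have "D Q \<subseteq> D P" unfolding D_def by (intro big_part_antimono closed_nbhd_mono that)
    moreover have "u \<notin> D Q"
      unfolding D_def using that(3) big_part_subset[of \<B> "closed_nbhd (set Q)"] by blast
    ultimately show ?thesis using that(2) finD by (metis psubsetI psubset_card_mono)
  qed
  have "?thesis" if "induced_path P" "length P \<le> m" for P
    using that
  proof (induction P rule: wf_induct_rule[OF wf_measures[of "[\<lambda>P. card (D P), length]"]])
    case (1 P)
    let ?N = "closed_nbhd (set P)"
    have IH: ?thesis if "induced_path Q" "length Q \<le> m"
      "card (D Q) < card (D P) \<or> card (D Q) = card (D P) \<and> length Q < length P" for Q
      using 1(1)[of Q] that by auto
    have N: "?N \<subseteq> verts G" "\<not> bramble_cover G \<B> ?N"
      using nbhd_verts no_cover 1 by blast+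
    have conD: "connected (G \<restriction> D P)" unfolding D_def using bramble N by (rule connected_big_part)
    have boundary: "v \<in> ?N" if "u \<in> D P" "u \<rightarrow> v" "v \<notin> D P" for u v
      using big_part_boundary[OF bramble N] that by (simp add: D_def)
    have D_nonadj: "x \<notin> set P" "\<not> x \<rightarrow> y" "\<not> y \<rightarrow> x" if "x \<in> D P" "y \<in> set P" for x y
      using that big_part_subset[of \<B> ?N] adj_sym by (auto simp: D_def closed_nbhd_def)
    \<comment> \<open>A proper part of the path whose closed neighbourhood still contains the boundary can replace it.\<close>
    have shorten: ?thesis
      if "induced_path Q" "set Q \<subseteq> set P" "length Q < length P"
        "\<And>u v. u \<in> D P \<Longrightarrow> u \<rightarrow> v \<Longrightarrow> v \<notin> D P \<Longrightarrow> v \<in> closed_nbhd (set Q)" for Q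
    proof -
      have "D Q = D P" unfolding D_def
        by (rule big_part_eqI[OF bramble N closed_nbhd_mono[OF that(2)]]) (use that(4) D_def in auto)
      then show ?thesis using IH[of Q] that 1(3) by simp
    qed
    show ?case
    proof (cases "P = []")
      case True
      \<comment> \<open>Nothing is removed yet, so any vertex of the big part starts a path that shrinks it.\<close>
      obtain x where "x \<in> D P" using conD connected_induce_iff[OF D_verts[of P]] by blast
      moreover have "induced_path [x]" using calculation D_verts by auto
      moreover have "x \<in> closed_nbhd (set [x])" by (simp add: closed_nbhd_def)
      ultimately show ?thesis using IH[of "[x]"] shrink[of P "[x]" x] True \<open>2 \<le> m\<close> by simp
    next
      case P: False
      show ?thesis
      proof (rule ccontr)
        assume no_cycle: "\<not> ?thesis"
        have private_nbr: "\<exists>u v. u \<in> D P \<and> u \<rightarrow> v \<and> v \<notin> D P \<and> v \<notin> closed_nbhd (set Q)"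
          if "induced_path Q" "set Q \<subseteq> set P" "length Q < length P" for Q
          using shorten[OF that] no_cycle by blast
        have "set (tl P) \<subseteq> set P" "length (tl P) < length P" using P by (cases P; auto)+
        then obtain a u where a: "u \<in> D P" "u \<rightarrow> a" "a \<notin> D P" "a \<notin> closed_nbhd (set (tl P))"
          using private_nbr[OF induced_path_tl[OF 1(2)]] by blast
        have "set (butlast P) \<subseteq> set P" by (cases P rule: rev_cases) auto
        moreover have "length (butlast P) < length P" using P by simp
        ultimately obtain b w where b: "w \<in> D P" "w \<rightarrow> b" "b \<notin> D P" "b \<notin> closed_nbhd (set (butlast P))"
          using private_nbr[OF induced_path_butlast[OF 1(2)]] by blast
        have aP: "a \<notin> set P" "b \<notin> set P" using a b D_nonadj by blast+
        have ab_verts: "a \<in> verts G" "b \<in> verts G" using a b adj_in_verts by blast+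
        have setP: "set P = insert (hd P) (set (tl P))" "set P = insert (last P) (set (butlast P))"
          using P by (metis list.set(2) list.collapse)
            (metis P append_butlast_last_id list.set(1,2) set_append Un_insert_right Un_empty_right)
        have a_adj: "x \<rightarrow> a \<longleftrightarrow> x = hd P" if "x \<in> set P" for x
          using boundary[OF a(1-3)] a(4) aP(1) that setP(1) by (auto simp: closed_nbhd_def)
        have b_adj: "x \<rightarrow> b \<longleftrightarrow> x = last P" if "x \<in> set P" for x
          using boundary[OF b(1-3)] b(4) aP(2) that setP(2) by (auto simp: closed_nbhd_def)
        show False
        proof (cases "length P < m")
          case True
          \<comment> \<open>The neighbour \<open>w\<close> of \<open>b\<close> leaves the big part when \<open>b\<close> is appended.\<close>
          have "induced_path (P @ [b])"
            using 1(2) aP ab_verts b_adj by (auto simp: induced_path_append)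
          moreover have "w \<in> closed_nbhd (set (P @ [b]))"
            using b(2) adj_sym by (auto simp: closed_nbhd_def)
          ultimately show False
            using IH[of "P @ [b]"] shrink[of P "P @ [b]" w] b(1) True no_cycle by auto
        next
          case False
          then have len: "length P = m" using 1(3) by simp
          obtain v R where PR: "P = v # R" using P by (meson neq_Nil_conv)
          then have "R \<noteq> []" using len \<open>2 \<le> m\<close> by auto
          have "v \<notin> set R" using 1(2) PR by simp
          \<comment> \<open>The two ends of the path differ because \<open>2 \<le> m\<close>, and each sees only one of \<open>a\<close>, \<open>b\<close>.\<close>
          have "a \<noteq> b"
            using a_adj[of v] b_adj[of v] PR \<open>R \<noteq> []\<close> \<open>v \<notin> set R\<close> by auto
          have "connected (G \<restriction> insert b (insert a (D P)))"
            using connected_induce_insert[OF _ connected_induce_insert[OF D_verts conD a(1,2)], of w b]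
              ab_verts D_verts b by auto
          then obtain Q where Q: "induced_path Q" "Q \<noteq> []" "hd Q = b" "last Q = a"
              "set Q \<subseteq> insert b (insert a (D P))"
            using connected_induced_path[of "insert b (insert a (D P))" b a] ab_verts D_verts by auto
          have "length Q \<ge> 2"
            using Q(2-4) \<open>a \<noteq> b\<close> by (cases Q; cases "tl Q") auto
          have cross: "x \<rightarrow> y \<longleftrightarrow> x = hd P \<and> y = a \<or> x = last P \<and> y = b"
            if "x \<in> set P" "y \<in> set Q" for x y
            using that Q(5) a_adj b_adj D_nonadj \<open>a \<noteq> b\<close> a(3) b(3) by blast
          have disj: "set P \<inter> set Q = {}" using Q(5) aP D_nonadj by blast
          have hv: "hd P = v" "last P = last R" using PR \<open>R \<noteq> []\<close> by auto
          have "last R \<noteq> v" "hd R \<noteq> v" using \<open>v \<notin> set R\<close> \<open>R \<noteq> []\<close> by auto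
          have "induced_path (R @ Q)"
            using 1(2) Q(1,3) PR disj cross hv \<open>v \<notin> set R\<close> by (auto simp: induced_path_append)
          moreover have "v \<in> verts G" "v \<notin> set (R @ Q)" using 1(2) PR disj by auto
          moreover have "\<forall>y\<in>set (R @ Q). v \<rightarrow> y \<longleftrightarrow> y = hd (R @ Q) \<or> y = last (R @ Q)"
            using 1(2) PR cross[of v] hv \<open>last R \<noteq> v\<close> \<open>R \<noteq> []\<close> Q(2,4) disj a_adj aP
            by auto
          ultimately have "cycle_graph (Suc (length (R @ Q))) (G \<restriction> insert v (set (R @ Q)))"
            using \<open>length Q \<ge> 2\<close> by (intro induced_cycle_graph) auto
          moreover have "induced_subgraph (G \<restriction> insert v (set (R @ Q))) G"
            using \<open>v \<in> verts G\<close> induced_path_imp[OF \<open>induced_path (R @ Q)\<close>] by (intro induced_induce) auto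
          moreover have "m + 2 \<le> Suc (length (R @ Q))" using len PR \<open>length Q \<ge> 2\<close> by simp
          ultimately show False using no_cycle by blast
        qed
      qed
    qed
  qed
  from this[of "[]"] show ?thesis by simp
qed

section \<open>Independence number of neighbourhoods in star-free graphs\<close>

text \<open>
  An independent set that contains \<open>v\<close> is just \<open>{v}\<close>, which is small enough because \<open>2 \<le> d\<close>. Otherwise
  it consists of neighbours of \<open>v\<close>, and \<open>d\<close> of them would form an induced star with centre \<open>v\<close>.
\<close>

lemma independent_in_closed_nbhd_of_vertex:
  assumes "K1_free d G" "2 \<le> d" "v \<in> verts G" "independent_set G S" "S \<subseteq> closed_nbhd {v}"
  shows "card S \<le> d - 1"
proof (rule ccontr)
  assume "\<not> card S \<le> d - 1"
  then have card: "d \<le> card S" by simp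
  have "v \<notin> S"
  proof
    assume "v \<in> S"
    then have "S = {v}" using assms(4,5) by (auto simp: independent_set_def closed_nbhd_def)
    then show False using card assms(2) by simp
  qed
  then have adj: "v \<rightarrow> s" if "s \<in> S" for s using assms(5) that by (auto simp: closed_nbhd_def)
  obtain T where T: "T \<subseteq> S" "card T = d" using card obtain_subset_with_card_n by metis
  have sub: "insert v T \<subseteq> verts G" using T assms by (auto simp: independent_set_def)
  have "x \<rightarrow> y \<longleftrightarrow> x = v \<and> y \<in> T \<or> x \<in> T \<and> y = v" if "x \<in> insert v T" "y \<in> insert v T" for x y
    using that adj T(1) assms(4) adj_sym adj_irrefl unfolding independent_set_def by blast
  then have "arcs_ends (G \<restriction> insert v T) = {v} \<times> T \<union> T \<times> {v}" using adj_induce by auto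
  moreover have "insert v T = {v} \<union> T" "{v} \<inter> T = {}" "card {v} = 1" using T(1) \<open>v \<notin> S\<close> by auto
  ultimately have "K\<^bsub>1,d\<^esub> (G \<restriction> insert v T)"
    unfolding complete_bipartite_digraph_def induce_subgraph_verts
    using graph_induce[OF sub] T(2) by blast
  then show False using assms(1) induced_induce[OF sub] by (auto simp: K1_free_def)
qed

lemma alpha_closed_nbhd:
  assumes "K1_free d G" "2 \<le> d" "X \<subseteq> verts G"
  shows "alpha G (closed_nbhd X) \<le> (d - 1) * card X"
proof -
  let ?N = "closed_nbhd X"
  have N: "?N \<subseteq> verts G" using assms(3) by (rule closed_nbhd_subset_verts)
  then have finN: "finite ?N" using finite_verts finite_subset by blast
  have finX: "finite X" using assms(3) finite_verts finite_subset by blast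
  have bound: "card S \<le> (d - 1) * card X" if "independent_set (G \<restriction> ?N) S" for S
  proof -
    have "S \<subseteq> ?N" using that by (simp add: independent_set_def)
    moreover have "independent_set G S"
      using that N calculation unfolding independent_set_def adj_induce induce_subgraph_verts by blast
    ultimately have S: "S \<subseteq> ?N" "independent_set G S" .
    have "S = (\<Union>v\<in>X. S \<inter> closed_nbhd {v})" using S(1) unfolding closed_nbhd_def by blast
    then have "card S \<le> (\<Sum>v\<in>X. card (S \<inter> closed_nbhd {v}))" using card_UN_le[OF finX] by metis
    also have "\<dots> \<le> (\<Sum>v\<in>X. d - 1)"
      using assms S(2) by (intro sum_mono independent_in_closed_nbhd_of_vertex) (auto simp: independent_set_def)
    finally show ?thesis by (simp add: mult.commute)
  qed
  have "{S. independent_set (G \<restriction> ?N) S} \<subseteq> Pow ?N" by (auto simp: independent_set_def)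
  then have "finite {S. independent_set (G \<restriction> ?N) S}" using finN by (meson finite_Pow_iff finite_subset)
  then have "finite {card S | S. independent_set (G \<restriction> ?N) S}" by simp
  moreover have "independent_set (G \<restriction> ?N) {}" by (simp add: independent_set_def)
  ultimately show ?thesis
    unfolding alpha_def using bound by (subst Max_le_iff) auto
qed

lemma alpha_order_le:
  assumes "bramble_cover G \<B> X"
  shows "alpha_order G \<B> \<le> alpha G X"
proof -
  have "{X. bramble_cover G \<B> X} \<subseteq> Pow (verts G)" by (auto simp: bramble_cover_def)
  then have "finite {X. bramble_cover G \<B> X}" by (meson finite_Pow_iff finite_subset finite_verts)
  then show ?thesis unfolding alpha_order_def using assms by (intro Min_le) auto
qed

end

section \<open>Strong brambles of large order force long induced cycles\<close>

theorem corollary1p4: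
  fixes G :: "('a, 'b) pre_digraph" and \<B> :: "'a set set" and d k :: nat
  assumes "d \<ge> 2" and "k \<ge> 4"
    and "graph G"
    and "K1_free d G"
    and "strong_bramble G \<B>"
    and "alpha_order G \<B> \<ge> d * k"
  shows "\<exists>C n. induced_subgraph C G \<and> cycle_graph n C \<and> n \<ge> k"
proof -
  interpret graph G by fact
  have "\<not> bramble_cover G \<B> (closed_nbhd (set P))" if P: "induced_path P" "length P \<le> k - 2" for P
  proof
    assume "bramble_cover G \<B> (closed_nbhd (set P))"
    then have "d * k \<le> alpha G (closed_nbhd (set P))" using alpha_order_le assms(6) by (meson order_trans)
    also have "\<dots> \<le> (d - 1) * card (set P)"
      using alpha_closed_nbhd assms P induced_path_imp by blast
    also have "\<dots> \<le> (d - 1) * (k - 2)"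
      using P(2) card_length[of P] by (intro mult_le_mono2) linarith
    also have "\<dots> < d * k"
      using assms(1,2) by (intro mult_less_le_imp_less) auto
    finally show False by simp
  qed
  moreover have "2 \<le> k - 2" "k - 2 + 2 = k" using assms(2) by simp_all
  ultimately show ?thesis using long_induced_cycle[OF assms(5), of "k - 2"] by metis
qed

end
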